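(* Let $(\mathcal{X},d,\mu)$ be a space of homogeneous type with upper dimension $\omega$, let $\eta$ be the smoothness index of the wavelet system described in the context, and let $\theta\in(0,\eta/\omega)$. Then the following statements are equivalent: (i) $\mathrm{lip}_\theta(\mathcal{X})\subset L^\infty(\mathcal{X})$; (ii) there exists a positive constant $C$ such that, for any $x\in\mathcal{X}$, $\mu(B(x,1))\le C$.
   Context: **Space of homogeneous type.** $\mathcal{X}$ is a non-empty set, $d:\mathcal{X}\times\mathcal{X}\to[0,\infty)$ satisfies $d(x,y)=0\iff x=y$, $d(x,y)=d(y,x)$, and $d(x,z)\le A_0[d(x,y)+d(y,z)]$ for a constant $A_0\in[1,\infty)$; $\mu$ is a measure on $\mathcal{X}$ such that $\mu(2B)\le C\mu(B)$ for all balls $B=B(x_B,r_B):=\{x:d(x_B,x)<r_B\}$, where $\tau B:=B(x_B,\tau r_B)$. Standing assumptions: $\mu(\mathcal{X})=\infty$; for each $x$ the balls $\{B(x,r)\}_{r>0}$ form a basis of open neighborhoods of $x$; $\mu$ is Borel regular (open sets are measurable and every set $A$ lies in a Borel set $E$ with $\mu(A)=\mu(E)$); $\mu(B(x,r))\in(0,\infty)$ and $\mu(\{x\})=0$ for all $x$ and $r>0$. Put $C_{(\mu)}:=\sup_B\mu(2B)/\mu(B)$; the upper dimension is $\omega:=\log_2C_{(\mu)}$, so $\mu(\lambda B)\le C_{(\mu)}\lambda^\omega\mu(B)$ for $\lambda\ge1$. Write $V_r(x):=\mu(B(x,r))$. **Inhomogeneous Lipschitz space.** $L^q_{\mathcal{B}}(\mathcal{X})$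 ($q\in[1,\infty]$) is the set of measurable $f$ with $f\mathbf{1}_B\in L^q(\mathcal{X})$ for every ball $B$. For $\theta>0$ and a ball $B$ of radius $r_B$, let $\mathcal{M}^B_\theta(f):=\sup_{x,y\in B}|f(x)-f(y)|/[\mu(B)]^\theta$ if $r_B\in(0,1]$ and $\mathcal{M}^B_\theta(f):=\|f\|_{L^\infty(B)}/[\mu(B)]^\theta$ if $r_B\in(1,\infty)$. Then $\mathrm{lip}_\theta(\mathcal{X}):=\{f\in L^q_{\mathcal{B}}(\mathcal{X}):\|f\|_{\mathrm{lip}_\theta(\mathcal{X})}:=\sup_B\mathcal{M}^B_\theta(f)<\infty\}$ (the choice of $q$ is immaterial). **Dyadic system.** Fix $0<c_0<C_0$ and a (sufficiently small) $\delta\in(0,1)$ with $12A_0^3C_0\delta\le c_0$, countable index sets $\mathcal{A}_k$ and points $\{x_\alpha^k\}_{\alpha\in\mathcal{A}_k}$ ($k\in\mathbb{Z}$) with $d(x_\alpha^k,x_\beta^k)\ge c_0\delta^k$ for $\alpha\ne\beta$, $\min_{\alpha\in\mathcal{A}_k}d(x,x_\alpha^k)<C_0\delta^k$ for all $x$, and $\mathcal{X}^k:=\{x_\alpha^k:\alpha\in\mathcal{A}_k\}\subset\mathcal{X}^{k+1}$; let $\mathcal{G}_k:=\{\alpha\in\mathcal{A}_{k+1}:x_\alpha^{k+1}\in\mathcal{X}^{k+1}\setminus\mathcal{X}^k\}$. **Wavelets and $\eta$.** Fix the Auscher–Hytönen wavelet system: real-valued functions $\phi_\alpha^k$ ($k\in\mathbb{Z},\alpha\in\mathcal{A}_k$)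 and $\psi_\beta^{k+1}$ ($k\in\mathbb{Z},\beta\in\mathcal{G}_k$), and constants $s\in(0,1]$, $\eta\in(0,1)$ (the smoothness index), $\nu,C\in(0,\infty)$ such that, with $E_k(x,y):=\exp(-\nu[d(x,y)/\delta^k]^s)$: $|\phi_\alpha^k(x)|\le C[V_{\delta^k}(x_\alpha^k)]^{-1/2}E_k(x,x_\alpha^k)$; for $d(x,x')\le\delta^k$, $|\phi_\alpha^k(x)-\phi_\alpha^k(x')|\le C[V_{\delta^k}(x_\alpha^k)]^{-1/2}[d(x,x')/\delta^k]^\eta E_k(x,x_\alpha^k)$; the same two bounds hold for $\psi_\beta^{k+1}$ with $x_\alpha^k$ replaced by $x_\beta^{k+1}$ (and $\delta^k$, $E_k$ unchanged); $\int_{\mathcal{X}}\psi_\beta^{k+1}\,d\mu=0$; and for every $k_0\in\mathbb{Z}$, $\{\phi_\alpha^{k_0}\}_{\alpha\in\mathcal{A}_{k_0}}\cup\{\psi_\beta^{k+1}:k\ge k_0,\beta\in\mathcal{G}_k\}$ is an orthonormal basis of $L^2(\mathcal{X})$. *)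

theory Defs
  imports "HOL-Probability.Essential_Supremum"
begin

(* The underlying set is the carrier space M; the quasi-metric d is a total function whose
   values outside the carrier are irrelevant. *)

definition qball :: "'a measure \<Rightarrow> ('a \<Rightarrow> 'a \<Rightarrow> real) \<Rightarrow> 'a \<Rightarrow> real \<Rightarrow> 'a set" where
  "qball M d x r = {y \<in> space M. d x y < r}"

definition qtopology :: "'a measure \<Rightarrow> ('a \<Rightarrow> 'a \<Rightarrow> real) \<Rightarrow> 'a topology" where
  "qtopology M d =
     topology (\<lambda>U. U \<subseteq> space M \<and> (\<forall>x\<in>U. \<exists>r>0. qball M d x r \<subseteq> U))"

lemma openin_qtopology:
  "openin (qtopology M d) U \<longleftrightarrow>
     U \<subseteq> space M \<and> (\<forall>x\<in>U. \<exists>r>0. qball M d x r \<subseteq> U)"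
proof -
  have "istopology (\<lambda>U. U \<subseteq> space M \<and> (\<forall>x\<in>U. \<exists>r>0. qball M d x r \<subseteq> U))"
    unfolding istopology_def
  proof (intro conjI allI impI)
    fix S T
    assume S: "S \<subseteq> space M \<and> (\<forall>x\<in>S. \<exists>r>0. qball M d x r \<subseteq> S)"
      and T: "T \<subseteq> space M \<and> (\<forall>x\<in>T. \<exists>r>0. qball M d x r \<subseteq> T)"
    show "S \<inter> T \<subseteq> space M" using S by blast
    show "\<forall>x\<in>S \<inter> T. \<exists>r>0. qball M d x r \<subseteq> S \<inter> T"
    proof
      fix x assume "x \<in> S \<inter> T"
      then obtain r t where "r > 0" "qball M d x r \<subseteq> S" "t > 0" "qball M d x t \<subseteq> T"
        using S T by blast
      then show "\<exists>r>0. qball M d x r \<subseteq> S \<inter> T"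
        by (intro exI[of _ "min r t"]) (auto simp: qball_def)
    qed
  next
    fix K
    assume K: "\<forall>S\<in>K. S \<subseteq> space M \<and> (\<forall>x\<in>S. \<exists>r>0. qball M d x r \<subseteq> S)"
    then show "\<Union>K \<subseteq> space M" by blast
    show "\<forall>x\<in>\<Union>K. \<exists>r>0. qball M d x r \<subseteq> \<Union>K" using K by (meson Union_iff Union_upper order_trans)
  qed
  then show ?thesis unfolding qtopology_def by simp
qed

(* By the definition of qtopology, the balls centred at x form a basis of open neighbourhoods
   of x exactly when they are open (in a quasi-metric space this is not automatic).
   In the Borel regularity axiom, A is an arbitrary subset, hence the outer measure. *)
locale homogeneous_space =
  fixes M :: "'a measure" and d :: "'a \<Rightarrow> 'a \<Rightarrow> real" and A0 :: real
  assumes space_nonempty: "space M \<noteq> {}"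
    and A0_ge_1: "1 \<le> A0"
    and d_nonneg: "\<And>x y. x \<in> space M \<Longrightarrow> y \<in> space M \<Longrightarrow> 0 \<le> d x y"
    and d_eq_0_iff: "\<And>x y. x \<in> space M \<Longrightarrow> y \<in> space M \<Longrightarrow> d x y = 0 \<longleftrightarrow> x = y"
    and d_commute: "\<And>x y. x \<in> space M \<Longrightarrow> y \<in> space M \<Longrightarrow> d x y = d y x"
    and d_triangle: "\<And>x y z. x \<in> space M \<Longrightarrow> y \<in> space M \<Longrightarrow> z \<in> space M \<Longrightarrow>
          d x z \<le> A0 * (d x y + d y z)"
    and openin_qball: "\<And>x r. x \<in> space M \<Longrightarrow> 0 < r \<Longrightarrow> openin (qtopology M d) (qball M d x r)"
    and open_measurable: "\<And>U. openin (qtopology M d) U \<Longrightarrow> U \<in> sets M"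
    and borel_regular: "\<And>A. A \<subseteq> space M \<Longrightarrow>
          \<exists>E \<in> sigma_sets (space M) {U. openin (qtopology M d) U}.
            A \<subseteq> E \<and> outer_measure_of M A = emeasure M E"
    and doubling: "\<exists>C::real. \<forall>x\<in>space M. \<forall>r>0.
          emeasure M (qball M d x (2 * r)) \<le> ennreal C * emeasure M (qball M d x r)"
    and emeasure_space_infinite: "emeasure M (space M) = \<infinity>"
    and emeasure_qball_pos: "\<And>x r. x \<in> space M \<Longrightarrow> 0 < r \<Longrightarrow> 0 < emeasure M (qball M d x r)"
    and emeasure_qball_finite: "\<And>x r. x \<in> space M \<Longrightarrow> 0 < r \<Longrightarrow> emeasure M (qball M d x r) < \<infinity>"
    and emeasure_singleton_0: "\<And>x. x \<in> space M \<Longrightarrow> emeasure M {x} = 0"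

definition doubling_const :: "'a measure \<Rightarrow> ('a \<Rightarrow> 'a \<Rightarrow> real) \<Rightarrow> real" where
  "doubling_const M d =
     (SUP (x, r) \<in> space M \<times> {0<..}. measure M (qball M d x (2 * r)) / measure M (qball M d x r))"

definition upper_dim :: "'a measure \<Rightarrow> ('a \<Rightarrow> 'a \<Rightarrow> real) \<Rightarrow> real" where
  "upper_dim M d = log 2 (doubling_const M d)"

(* Lq_space M q, q in [1,\<infinity>], consists of functions, not of almost-everywhere classes. *)
definition Lq_space :: "'a measure \<Rightarrow> ennreal \<Rightarrow> ('a \<Rightarrow> 'k::real_normed_vector) set" where
  "Lq_space M q = {f \<in> borel_measurable M.
     if q = \<infinity> then esssup M (\<lambda>x. ennreal (norm (f x))) < \<infinity>
     else (\<integral>\<^sup>+x. ennreal (norm (f x) powr enn2real q) \<partial>M) < \<infinity>}"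

definition Lq_on_balls ::
    "'a measure \<Rightarrow> ('a \<Rightarrow> 'a \<Rightarrow> real) \<Rightarrow> ennreal \<Rightarrow> ('a \<Rightarrow> 'k::real_normed_vector) set" where
  "Lq_on_balls M d q = {f \<in> borel_measurable M. \<forall>x\<in>space M. \<forall>r>0.
     (\<lambda>y. indicat_real (qball M d x r) y *\<^sub>R f y) \<in> Lq_space M q}"

definition lip_osc ::
    "'a measure \<Rightarrow> ('a \<Rightarrow> 'a \<Rightarrow> real) \<Rightarrow> real \<Rightarrow> ('a \<Rightarrow> 'k::real_normed_vector) \<Rightarrow> 'a \<Rightarrow> real \<Rightarrow> ennreal"
  where
  "lip_osc M d \<theta> f x r =
     (let B = qball M d x r in
      (if r \<le> 1 then (SUP (y, z) \<in> B \<times> B. ennreal (norm (f y - f z)))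
       else esssup (restrict_space M B) (\<lambda>y. ennreal (norm (f y))))
      / ennreal (measure M B powr \<theta>))"

definition lip_norm ::
    "'a measure \<Rightarrow> ('a \<Rightarrow> 'a \<Rightarrow> real) \<Rightarrow> real \<Rightarrow> ('a \<Rightarrow> 'k::real_normed_vector) \<Rightarrow> ennreal" where
  "lip_norm M d \<theta> f = (SUP (x, r) \<in> space M \<times> {0<..}. lip_osc M d \<theta> f x r)"

definition lip_space ::
    "'a measure \<Rightarrow> ('a \<Rightarrow> 'a \<Rightarrow> real) \<Rightarrow> ennreal \<Rightarrow> real \<Rightarrow> ('a \<Rightarrow> 'k::real_normed_vector) set" where
  "lip_space M d q \<theta> = {f \<in> Lq_on_balls M d q. lip_norm M d \<theta> f < \<infinity>}"

(* An orthonormal family whose finite linear combinations are dense in real L^2. *)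
definition orthonormal_basis_L2 :: "'a measure \<Rightarrow> 'j set \<Rightarrow> ('j \<Rightarrow> 'a \<Rightarrow> real) \<Rightarrow> bool" where
  "orthonormal_basis_L2 M J e \<longleftrightarrow>
     (\<forall>i\<in>J. e i \<in> Lq_space M 2) \<and>
     (\<forall>i\<in>J. \<forall>j\<in>J. (\<integral>x. e i x * e j x \<partial>M) = (if i = j then 1 else 0)) \<and>
     (\<forall>f\<in>Lq_space M 2. \<forall>\<epsilon>>0. \<exists>F c. finite F \<and> F \<subseteq> J \<and>
        (\<integral>x. (f x - (\<Sum>j\<in>F. c j * e j x))\<^sup>2 \<partial>M) < \<epsilon>)"

(* z k \<alpha> is the dyadic point of level k with index \<alpha>. *)
locale dyadic_system = homogeneous_space M d A0
  for M :: "'a measure" and d :: "'a \<Rightarrow> 'a \<Rightarrow> real" and A0 :: real +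
  fixes c0 C0 \<delta> :: real and A :: "int \<Rightarrow> 'i set" and z :: "int \<Rightarrow> 'i \<Rightarrow> 'a"
  assumes c0_pos: "0 < c0" and c0_less_C0: "c0 < C0"
    and \<delta>_pos: "0 < \<delta>" and \<delta>_less_1: "\<delta> < 1" and \<delta>_small: "12 * A0 ^ 3 * C0 * \<delta> \<le> c0"
    and countable_A: "\<And>k. countable (A k)"
    and z_in_space: "\<And>k \<alpha>. \<alpha> \<in> A k \<Longrightarrow> z k \<alpha> \<in> space M"
    and z_separated: "\<And>k \<alpha> \<beta>. \<alpha> \<in> A k \<Longrightarrow> \<beta> \<in> A k \<Longrightarrow> \<alpha> \<noteq> \<beta> \<Longrightarrow>
          c0 * \<delta> powi k \<le> d (z k \<alpha>) (z k \<beta>)"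
    and z_dense: "\<And>k x. x \<in> space M \<Longrightarrow>
          \<exists>\<alpha>\<in>A k. (\<forall>\<beta>\<in>A k. d x (z k \<alpha>) \<le> d x (z k \<beta>)) \<and> d x (z k \<alpha>) < C0 * \<delta> powi k"
    and z_nested: "\<And>k. z k ` A k \<subseteq> z (k + 1) ` A (k + 1)"

definition new_indices :: "(int \<Rightarrow> 'i set) \<Rightarrow> (int \<Rightarrow> 'i \<Rightarrow> 'a) \<Rightarrow> int \<Rightarrow> 'i set" where
  "new_indices A z k = {\<alpha> \<in> A (k + 1). z (k + 1) \<alpha> \<in> z (k + 1) ` A (k + 1) - z k ` A k}"

(* Size and Hoelder bounds at scale \<rho> for a function g centred at p. *)
definition wavelet_bounds ::
    "'a measure \<Rightarrow> ('a \<Rightarrow> 'a \<Rightarrow> real) \<Rightarrow> real \<Rightarrow> real \<Rightarrow> real \<Rightarrow> real \<Rightarrow> real \<Rightarrow> 'a \<Rightarrow> ('a \<Rightarrow> real) \<Rightarrow> bool"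
  where
  "wavelet_bounds M d s \<eta> \<nu> C \<rho> p g \<longleftrightarrow>
     (\<forall>x\<in>space M. \<bar>g x\<bar> \<le> C * measure M (qball M d p \<rho>) powr (- 1 / 2)
        * exp (- \<nu> * (d x p / \<rho>) powr s)) \<and>
     (\<forall>x\<in>space M. \<forall>x'\<in>space M. d x x' \<le> \<rho> \<longrightarrow>
        \<bar>g x - g x'\<bar> \<le> C * measure M (qball M d p \<rho>) powr (- 1 / 2)
          * (d x x' / \<rho>) powr \<eta> * exp (- \<nu> * (d x p / \<rho>) powr s))"

(* The wavelet of level k + 1 is \<psi> (k + 1) \<beta>, with \<beta> in new_indices A z k; its decay is
   measured at scale \<delta>^k, not \<delta>^(k + 1). *)
locale wavelet_system = dyadic_system M d A0 c0 C0 \<delta> A z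
  for M :: "'a measure" and d :: "'a \<Rightarrow> 'a \<Rightarrow> real" and A0 c0 C0 \<delta> :: real
    and A :: "int \<Rightarrow> 'i set" and z :: "int \<Rightarrow> 'i \<Rightarrow> 'a" +
  fixes \<phi> \<psi> :: "int \<Rightarrow> 'i \<Rightarrow> 'a \<Rightarrow> real" and s \<eta> \<nu> C :: real
  assumes s_pos: "0 < s" and s_le_1: "s \<le> 1"
    and \<eta>_pos: "0 < \<eta>" and \<eta>_less_1: "\<eta> < 1"
    and \<nu>_pos: "0 < \<nu>" and C_pos: "0 < C"
    and \<phi>_bounds: "\<And>k \<alpha>. \<alpha> \<in> A k \<Longrightarrow>
          wavelet_bounds M d s \<eta> \<nu> C (\<delta> powi k) (z k \<alpha>) (\<phi> k \<alpha>)"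
    and \<psi>_bounds: "\<And>k \<beta>. \<beta> \<in> new_indices A z k \<Longrightarrow>
          wavelet_bounds M d s \<eta> \<nu> C (\<delta> powi k) (z (k + 1) \<beta>) (\<psi> (k + 1) \<beta>)"
    and \<psi>_cancellation: "\<And>k \<beta>. \<beta> \<in> new_indices A z k \<Longrightarrow>
          has_bochner_integral M (\<psi> (k + 1) \<beta>) 0"
    and orthonormal_basis: "\<And>k0. orthonormal_basis_L2 M
          (A k0 <+> (SIGMA k:{k0..}. new_indices A z k))
          (case_sum (\<lambda>\<alpha>. \<phi> k0 \<alpha>) (\<lambda>(k, \<beta>). \<psi> (k + 1) \<beta>))"

end

(* If the unit balls have measure at most B, the L^infinity part of the lip_theta norm bounds f
   a.e. on each of countably many balls B(z_alpha, R), z_alpha in X^0, which cover the space.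

   Conversely, let V_alpha = mu(B(z_alpha, 1)) and f = sup_alpha V_alpha^(theta + 1/2) |phi^0_alpha|.
   Using a supremum instead of a wavelet series avoids all convergence questions: size and
   oscillation bounds that are uniform in alpha pass to f.  The size bound is
   V_alpha^theta exp(-nu d(y, z_alpha)^s) <= K min(r, 1)^(-omega theta) mu(B(x, r))^theta for y in
   B(x, r), because the doubling property compares B(z_alpha, 1) and B(x, r) at the price of a power
   of 1 + d(y, z_alpha), which the exponential absorbs.  The factor r^eta of the Hoelder bound
   compensates r^(-omega theta), so f lies in lip_theta.  If f <= N almost everywhere, then
   |phi^0_alpha| <= N V_alpha^(-theta - 1/2), and
   1 = ||phi^0_alpha||_2^2 <= ||phi^0_alpha||_infinity ||phi^0_alpha||_1 <= N K V_alpha^(-theta)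
   bounds V_alpha. *)

theory Submission
  imports Defs "HOL-Real_Asymp.Real_Asymp"
begin

section \<open>Two auxiliary facts about real functions and suprema\<close>

lemma powr_exp_bounded:
  fixes a \<nu> s :: real
  assumes "0 < \<nu>" "0 < s"
  shows "\<exists>K>0. \<forall>t\<ge>0. (1 + t) powr a * exp (- \<nu> * t powr s) \<le> K"
proof -
  define g where "g t = (1 + t) powr a * exp (- \<nu> * t powr s)" for t
  \<comment> \<open>The stretched exponential beats every power, so beyond some \<open>T\<close> the
    bound 1 works; on the compact interval that remains, continuity gives a bound.\<close>
  have "(g \<longlongrightarrow> 0) at_top"
    unfolding g_def using assms by real_asymp
  then have "\<forall>\<^sub>F t in at_top. g t < 1"
    by (rule order_tendstoD) simp
  then obtain T where T: "\<And>t. t \<ge> T \<Longrightarrow> g t < 1"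
    unfolding eventually_at_top_linorder by blast
  have "continuous_on {0..max T 0} g"
    unfolding g_def using assms by (intro continuous_intros continuous_on_powr') auto
  then have "bounded (g ` {0..max T 0})"
    by (intro compact_imp_bounded compact_continuous_image) auto
  then obtain B where B: "\<And>t. t \<in> {0..max T 0} \<Longrightarrow> g t \<le> B"
    unfolding bounded_iff by (metis image_eqI abs_le_D1 real_norm_def)
  have "g t \<le> max B 1" if "t \<ge> 0" for t
    using T[of t] B[of t] that by (cases "t \<ge> T") auto
  then show ?thesis
    unfolding g_def by (intro exI[of _ "max B 1"]) auto
qed

text \<open>Each \<open>f i\<close> is at most \<open>g i + c\<close>, hence at most the supremum of
  \<open>g\<close> plus \<open>c\<close>; exchanging the roles gives the other half. In this way an
  oscillation bound that is uniform in the index reaches a supremum of wavelets.\<close>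

lemma abs_cSUP_diff_le:
  fixes f g :: "'b \<Rightarrow> real"
  assumes "I \<noteq> {}" "bdd_above (f ` I)" "bdd_above (g ` I)"
    and "\<And>i. i \<in> I \<Longrightarrow> \<bar>f i - g i\<bar> \<le> c"
  shows "\<bar>(SUP i\<in>I. f i) - (SUP i\<in>I. g i)\<bar> \<le> c"
proof -
  have *: "(SUP i\<in>I. f i) \<le> (SUP i\<in>I. g i) + c"
    if "bdd_above (g ` I)" "\<And>i. i \<in> I \<Longrightarrow> \<bar>f i - g i\<bar> \<le> c" for f g :: "'b \<Rightarrow> real"
  proof (rule cSUP_least)
    fix i assume i: "i \<in> I"
    then show "f i \<le> (SUP i\<in>I. g i) + c"
      using that(2)[OF i] cSUP_upper[OF i that(1)] by linarith
  qed (rule assms(1))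
  show ?thesis
    using *[of g f] *[of f g] assms by (simp add: abs_le_iff abs_minus_commute)
qed

section \<open>Doubling: comparison of ball measures and estimates for exponentials\<close>

context homogeneous_space
begin

lemma qball_sets: "x \<in> space M \<Longrightarrow> qball M d x r \<in> sets M"
proof (cases "0 < r")
  case False
  then show "x \<in> space M \<Longrightarrow> ?thesis"
    using d_nonneg[of x] by (fastforce simp: qball_def intro: subst[of "{}" _ "\<lambda>X. X \<in> sets M"])
qed (simp add: open_measurable openin_qball)

lemma emeasure_qball_eq:
  "x \<in> space M \<Longrightarrow> 0 < r \<Longrightarrow> emeasure M (qball M d x r) = ennreal (measure M (qball M d x r))"
  using emeasure_qball_finite[of x r] by (simp add: emeasure_eq_ennreal_measure)

lemma measure_qball_pos: "x \<in> space M \<Longrightarrow> 0 < r \<Longrightarrow> 0 < measure M (qball M d x r)"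
  using emeasure_qball_pos[of x r] by (simp add: emeasure_qball_eq)

lemma measure_qball_mono:
  assumes "x \<in> space M" "0 < r" "y \<in> space M" "0 < r'" "qball M d x r \<subseteq> qball M d y r'"
  shows "measure M (qball M d x r) \<le> measure M (qball M d y r')"
  using emeasure_mono[OF assms(5) qball_sets[OF assms(3)]] assms
  by (simp add: emeasure_qball_eq)

lemma measure_qball_double:
  assumes "x \<in> space M" "0 < r"
  shows "measure M (qball M d x (2 * r)) \<le> doubling_const M d * measure M (qball M d x r)"
proof -
  obtain C where C: "\<And>x r. x \<in> space M \<Longrightarrow> 0 < r \<Longrightarrow>
      emeasure M (qball M d x (2 * r)) \<le> ennreal C * emeasure M (qball M d x r)"
    using doubling by blast
  \<comment> \<open>A real supremum says something only for a bounded family, so the ratios that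
    define \<open>doubling_const\<close> are bounded first. The constant of the doubling axiom is an
    arbitrary real, and \<open>ennreal\<close> sends negative numbers to 0; hence
    \<open>max C 0\<close>.\<close>
  have ratio: "measure M (qball M d x (2 * r)) / measure M (qball M d x r) \<le> max C 0"
    if "x \<in> space M" "0 < r" for x r
  proof -
    have "ennreal (measure M (qball M d x (2 * r))) \<le> ennreal (max C 0 * measure M (qball M d x r))"
      using order_trans[OF C[OF that] mult_right_mono[OF ennreal_leI[OF max.cobounded1[of C 0]]]] that
      by (simp add: emeasure_qball_eq ennreal_mult')
    then show ?thesis
      using measure_qball_pos[OF that] by (simp add: divide_le_eq ennreal_le_iff)
  qed
  have "measure M (qball M d x (2 * r)) / measure M (qball M d x r) \<le> doubling_const M d"
    unfolding doubling_const_def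
    by (rule cSUP_upper2[of _ _ "(x, r)"]) (use assms ratio in \<open>auto intro!: bdd_aboveI2[of _ _ "max C 0"]\<close>)
  then show ?thesis
    using measure_qball_pos[OF assms] by (simp add: divide_le_eq)
qed

lemma doubling_const_ge_1: "1 \<le> doubling_const M d"
proof -
  obtain x where x: "x \<in> space M" using space_nonempty by blast
  have "1 * measure M (qball M d x 1) \<le> measure M (qball M d x (2 * 1))"
    using x by (subst mult_1, intro measure_qball_mono) (auto simp: qball_def)
  also have "\<dots> \<le> doubling_const M d * measure M (qball M d x 1)"
    using x by (intro measure_qball_double) auto
  finally show ?thesis
    using measure_qball_pos[OF x, of 1] by simp
qed

lemma upper_dim_nonneg: "0 \<le> upper_dim M d"
  using doubling_const_ge_1 by (simp add: upper_dim_def)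

lemma measure_qball_pow2:
  assumes "x \<in> space M" "0 < r"
  shows "measure M (qball M d x (2 ^ m * r)) \<le> doubling_const M d ^ m * measure M (qball M d x r)"
proof (induction m)
  case (Suc m)
  have "measure M (qball M d x (2 ^ Suc m * r))
      \<le> doubling_const M d * measure M (qball M d x (2 ^ m * r))"
    using measure_qball_double[of x "2 ^ m * r"] assms by (simp add: mult.assoc)
  also have "\<dots> \<le> doubling_const M d * (doubling_const M d ^ m * measure M (qball M d x r))"
    using Suc doubling_const_ge_1 by (intro mult_left_mono) auto
  finally show ?case by (simp add: mult_ac)
qed simp

text \<open>Rounding \<open>l\<close> up to the power \<open>2 ^ Suc m\<close> with \<open>m\<close>
  the integer part of \<open>log 2 l\<close> costs one extra doubling constant D. The other
  \<open>m\<close> doublings cost at most \<open>D powr log 2 l\<close>, since D is at least 1, and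
  this equals \<open>l\<close> to the power \<open>log 2 D\<close>, the upper dimension.\<close>

lemma measure_qball_scale:
  assumes "x \<in> space M" "0 < r" "1 \<le> l"
  shows "measure M (qball M d x (l * r))
    \<le> doubling_const M d * l powr upper_dim M d * measure M (qball M d x r)"
proof -
  let ?D = "doubling_const M d"
  define m where "m = nat \<lfloor>log 2 l\<rfloor>"
  have m: "real m \<le> log 2 l" "log 2 l < real m + 1"
    using assms(3) unfolding m_def by (auto simp: le_floor_iff nat_less_real_le)
  have l: "l = 2 powr log 2 l" using assms by simp
  have "l \<le> 2 powr real (Suc m)"
    by (subst l, rule powr_mono) (use m in auto)
  then have "l \<le> 2 ^ Suc m" by (subst (asm) powr_realpow) auto
  then have "measure M (qball M d x (l * r)) \<le> measure M (qball M d x (2 ^ Suc m * r))"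
    using assms by (intro measure_qball_mono)
      (auto simp: qball_def intro: less_le_trans[OF _ mult_right_mono])
  also have "\<dots> \<le> ?D ^ Suc m * measure M (qball M d x r)"
    by (rule measure_qball_pow2) (use assms in auto)
  also have "?D ^ Suc m = ?D * ?D powr real m"
    using doubling_const_ge_1 by (simp add: powr_realpow)
  also have "?D powr real m \<le> ?D powr log 2 l"
    using m doubling_const_ge_1 by (intro powr_mono) auto
  also have "?D powr log 2 l = l powr upper_dim M d"
    using doubling_const_ge_1 assms(3) unfolding upper_dim_def powr_def log_def by simp
  finally show ?thesis
    using doubling_const_ge_1 by (simp add: mult_left_mono mult_right_mono)
qed

text \<open>Combined with the decay of a wavelet of scale 1 centred at \<open>p\<close>, this bounds
  its L^1 norm; the constant has to serve all centres at once.\<close>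

lemma nn_integral_exp_le:
  assumes "0 < \<nu>" "0 < s"
  shows "\<exists>K>0. \<forall>p\<in>space M. (\<integral>\<^sup>+x. ennreal (exp (- \<nu> * d x p powr s)) \<partial>M)
            \<le> ennreal (K * measure M (qball M d p 1))"
proof -
  let ?D = "doubling_const M d" and ?w = "upper_dim M d"
  obtain K where "K > 0"
    and K: "\<And>t. t \<ge> 0 \<Longrightarrow> (1 + t) powr (?w + 1) * exp (- \<nu> * t powr s) \<le> K"
    using powr_exp_bounded[OF assms] by blast
  have "(\<integral>\<^sup>+x. ennreal (exp (- \<nu> * d x p powr s)) \<partial>M)
            \<le> ennreal (2 * K * ?D * 2 powr ?w * measure M (qball M d p 1))"
    if p: "p \<in> space M" for p
  proof -
    \<comment> \<open>Dyadic balls around p: the exponent upper_dim + 1 beats the growth of their measures.\<close>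
    let ?b = "\<lambda>j. K * (2 ^ j) powr - (?w + 1)" and ?B = "\<lambda>j::nat. qball M d p (2 ^ Suc j)"
    have "ennreal (exp (- \<nu> * d x p powr s)) \<le> (\<Sum>j. ennreal (?b j) * indicator (?B j) x)"
      if x: "x \<in> space M" for x
    proof -
      define t where "t = d x p"
      have t: "0 \<le> t" using d_nonneg x p by (simp add: t_def)
      \<comment> \<open>Chosen so that \<open>2 ^ j \<le> 1 + t < 2 ^ Suc j\<close>: the right half
        puts \<open>x\<close> into the ball \<open>?B j\<close>, the left half bounds the
        exponential by \<open>?b j\<close>. Taking \<open>1 + t\<close> instead of \<open>t\<close>
        keeps the logarithm nonnegative, so points near \<open>p\<close> are covered by
        \<open>j = 0\<close>.\<close>
      define j where "j = nat \<lfloor>log 2 (1 + t)\<rfloor>"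
      have "0 \<le> log 2 (1 + t)" using t by simp
      then have "real j \<le> log 2 (1 + t)" "log 2 (1 + t) < real (Suc j)"
        unfolding j_def by linarith+
      then have "2 powr real j \<le> 1 + t" "1 + t < 2 powr real (Suc j)"
        using t by (simp_all add: le_log_iff log_less_iff)
      then have j: "2 ^ j \<le> 1 + t" "1 + t < 2 ^ Suc j"
        by (simp_all only: powr_realpow)
      then have xj: "x \<in> ?B j"
        using x p d_commute[of x p] by (simp add: qball_def t_def)
      have "exp (- \<nu> * t powr s) \<le> K * (1 + t) powr - (?w + 1)"
        using K[OF t] t by (simp only: powr_minus) (simp add: field_simps)
      also have "\<dots> \<le> ?b j"
        using j(1) \<open>K > 0\<close> upper_dim_nonneg by (intro mult_left_mono powr_mono2') auto
      finally have "ennreal (exp (- \<nu> * t powr s)) \<le> ennreal (?b j) * indicator (?B j) x"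
        using xj by (simp add: ennreal_leI)
      also have "\<dots> \<le> (\<Sum>j. ennreal (?b j) * indicator (?B j) x)"
      proof -
        have "h j \<le> suminf h" for h :: "nat \<Rightarrow> ennreal"
          using sum_le_suminf[of h "{j}"] by simp
        then show ?thesis .
      qed
      finally show ?thesis by (simp add: t_def)
    qed
    then have "(\<integral>\<^sup>+x. ennreal (exp (- \<nu> * d x p powr s)) \<partial>M)
        \<le> (\<integral>\<^sup>+x. (\<Sum>j. ennreal (?b j) * indicator (?B j) x) \<partial>M)"
      by (rule nn_integral_mono)
    also have "\<dots> = (\<Sum>j. ennreal (?b j) * emeasure M (?B j))"
      using qball_sets[OF p] by (subst nn_integral_suminf) (auto simp: nn_integral_cmult_indicator)
    also have "\<dots> \<le> (\<Sum>j. ennreal (K * ?D * 2 powr ?w * measure M (qball M d p 1) * (1 / 2) ^ j))"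
    proof (rule suminf_le)
      fix j :: nat
      have "?b j * measure M (?B j)
          \<le> ?b j * (?D * (2 ^ Suc j) powr ?w * measure M (qball M d p 1))"
        using measure_qball_scale[OF p zero_less_one one_le_power[of 2 "Suc j"]] \<open>K > 0\<close>
        by (intro mult_left_mono) auto
      also have "(2 ^ Suc j) powr ?w = 2 powr ?w * (2 ^ j) powr ?w"
        by (simp add: powr_mult)
      also have "?b j * (?D * (2 powr ?w * (2 ^ j) powr ?w) * measure M (qball M d p 1))
          = K * ?D * 2 powr ?w * measure M (qball M d p 1) * ((2 ^ j) powr - (?w + 1) * (2 ^ j) powr ?w)"
        by (simp only: mult_ac)
      \<comment> \<open>The exponents add up to -1, which leaves a geometric series of ratio 1/2 and
        sum 2.\<close>
      also have "(2 ^ j) powr - (?w + 1) * (2 ^ j) powr ?w = (1 / 2 :: real) ^ j"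
        by (subst powr_add[symmetric]) (simp add: powr_neg_one power_one_over)
      finally show "ennreal (?b j) * emeasure M (?B j)
          \<le> ennreal (K * ?D * 2 powr ?w * measure M (qball M d p 1) * (1 / 2) ^ j)"
        using p \<open>K > 0\<close> by (simp add: emeasure_qball_eq ennreal_mult[symmetric] ennreal_leI)
    qed auto
    also have "\<dots> = ennreal (\<Sum>j. K * ?D * 2 powr ?w * measure M (qball M d p 1) * (1 / 2) ^ j)"
      using \<open>K > 0\<close> doubling_const_ge_1 by (intro suminf_ennreal2) (auto intro!: summable_mult)
    also have "(\<Sum>j. K * ?D * 2 powr ?w * measure M (qball M d p 1) * (1 / 2) ^ j)
        = K * ?D * 2 powr ?w * measure M (qball M d p 1) * 2"
      by (subst suminf_mult) (auto simp: suminf_geometric)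
    finally show ?thesis by (simp add: mult_ac)
  qed
  then show ?thesis
    using \<open>K > 0\<close> doubling_const_ge_1
    by (intro exI[of _ "2 * K * ?D * 2 powr ?w"]) (auto intro!: mult_pos_pos)
qed

text \<open>Allows a bump centred at any \<open>p\<close> to be measured against a ball around the
  point of evaluation, with a constant independent of \<open>p\<close>; small radii pay the negative
  power of \<open>r\<close>.\<close>

lemma weighted_exp_le:
  assumes "0 < \<nu>" "0 < s" "0 < \<theta>"
  shows "\<exists>K>0. \<forall>p\<in>space M. \<forall>x\<in>space M. \<forall>r>0. \<forall>y\<in>qball M d x r.
     measure M (qball M d p 1) powr \<theta> * exp (- \<nu> * d y p powr s)
       \<le> K * min r 1 powr - (upper_dim M d * \<theta>) * measure M (qball M d x r) powr \<theta>"
proof -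
  let ?D = "doubling_const M d" and ?w = "upper_dim M d"
  obtain K where "K > 0"
    and K: "\<And>t. t \<ge> 0 \<Longrightarrow> (1 + t) powr (?w * \<theta>) * exp (- \<nu> * t powr s) \<le> K"
    using powr_exp_bounded[OF assms(1,2)] by blast
  \<comment> \<open>What remains of the doubling factor \<open>?D * l powr ?w\<close>, raised to the
    power \<theta>, once \<open>1 + t\<close> and \<open>min r 1\<close> are split off from the
    dilation factor \<open>l\<close> below.\<close>
  define K' where "K' = (?D * (2 * A0\<^sup>2) powr ?w) powr \<theta>"
  have "K' > 0"
    using doubling_const_ge_1 A0_ge_1 by (auto simp: K'_def)
  have "measure M (qball M d p 1) powr \<theta> * exp (- \<nu> * d y p powr s)
       \<le> K' * K * min r 1 powr - (?w * \<theta>) * measure M (qball M d x r) powr \<theta>"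
    if p: "p \<in> space M" and x: "x \<in> space M" and r: "r > 0" and y: "y \<in> qball M d x r" for p x r y
  proof -
    define t where "t = d y p"
    have yM: "y \<in> space M" "d x y < r" using y by (auto simp: qball_def)
    have t: "0 \<le> t" using d_nonneg yM p by (simp add: t_def)
    \<comment> \<open>Two quasi-triangle inequalities, through \<open>y\<close> and then
      \<open>p\<close>, put the unit ball at \<open>p\<close> inside the ball at \<open>x\<close> of
      radius \<open>A0 * (r + A0 * (1 + t))\<close>. Both \<open>r\<close> and \<open>1 + t\<close>
      are at most \<open>(1 + t) * (r / min r 1)\<close>, whence the 2; so \<open>l * r\<close>
      dominates this radius for small and large \<open>r\<close> alike.\<close>
    define l where "l = 2 * A0\<^sup>2 * (1 + t) / min r 1"
    have A1: "1 \<le> A0\<^sup>2" using A0_ge_1 by simp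
    have A2: "A0 \<le> A0\<^sup>2" using A0_ge_1 by (simp add: power2_eq_square)
    have one: "1 * 1 \<le> A0\<^sup>2 * (1 + t)" by (rule mult_mono) (use A1 t in auto)
    have "min r 1 \<le> 2 * A0\<^sup>2 * (1 + t)" using one by linarith
    then have l1: "1 \<le> l" using r by (simp add: l_def)
    have lr: "A0 * (r + A0 * (1 + t)) \<le> l * r"
    proof -
      have "A0 * r \<le> A0\<^sup>2 * r" using A2 r by simp
      then have "A0 * (r + A0 * (1 + t)) \<le> A0\<^sup>2 * (r + (1 + t))"
        by (simp add: power2_eq_square algebra_simps)
      also have "\<dots> \<le> A0\<^sup>2 * (2 * (1 + t) * (r / min r 1))"
      proof (intro mult_left_mono)
        show "r + (1 + t) \<le> 2 * (1 + t) * (r / min r 1)"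
        proof (cases "r \<le> 1")
          case False
          then have "1 + t \<le> (1 + t) * r" "r \<le> (1 + t) * r"
            using t by (auto simp: mult_le_cancel_left1 mult_le_cancel_right1)
          then show ?thesis using False by (simp add: min_def algebra_simps)
        qed (use r t in auto)
      qed (use A1 in auto)
      also have "\<dots> = l * r" by (simp add: l_def)
      finally show ?thesis .
    qed
    have "qball M d p 1 \<subseteq> qball M d x (l * r)"
    proof
      fix u assume "u \<in> qball M d p 1"
      then have u: "u \<in> space M" "d p u < 1" by (auto simp: qball_def)
      have "d y u \<le> A0 * (t + d p u)" unfolding t_def using d_triangle yM p u by blast
      also have "\<dots> \<le> A0 * (1 + t)" using u A0_ge_1 by (intro mult_left_mono) auto
      finally have "d x y + d y u < r + A0 * (1 + t)" using yM by linarith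
      then have "A0 * (d x y + d y u) < A0 * (r + A0 * (1 + t))" using A0_ge_1 by simp
      then have "d x u < l * r" using d_triangle[OF x yM(1) u(1)] lr by linarith
      then show "u \<in> qball M d x (l * r)" using u by (simp add: qball_def)
    qed
    then have "measure M (qball M d p 1) \<le> measure M (qball M d x (l * r))"
      using p x r l1 by (intro measure_qball_mono) auto
    also have "\<dots> \<le> ?D * l powr ?w * measure M (qball M d x r)"
      by (rule measure_qball_scale[OF x r l1])
    also have "\<dots> = ?D * (2 * A0\<^sup>2) powr ?w * ((1 + t) powr ?w * min r 1 powr - ?w
        * measure M (qball M d x r))"
      using t A0_ge_1 r by (simp add: l_def powr_mult powr_divide powr_minus divide_simps)
    finally have "measure M (qball M d p 1) powr \<theta> \<le> \<dots> powr \<theta>"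
      using assms by (intro powr_mono2) auto
    also have "\<dots> = K' * ((1 + t) powr (?w * \<theta>) * min r 1 powr - (?w * \<theta>)
        * measure M (qball M d x r) powr \<theta>)"
      using doubling_const_ge_1 t r by (simp add: K'_def powr_mult powr_powr)
    finally have "measure M (qball M d p 1) powr \<theta> * exp (- \<nu> * t powr s)
       \<le> K' * ((1 + t) powr (?w * \<theta>) * min r 1 powr - (?w * \<theta>)
        * measure M (qball M d x r) powr \<theta>) * exp (- \<nu> * t powr s)"
      by (rule mult_right_mono) simp
    also have "\<dots> = K' * min r 1 powr - (?w * \<theta>) * measure M (qball M d x r) powr \<theta>
        * ((1 + t) powr (?w * \<theta>) * exp (- \<nu> * t powr s))"
      by (simp add: mult_ac)
    also have "\<dots> \<le> K' * min r 1 powr - (?w * \<theta>) * measure M (qball M d x r) powr \<theta> * K"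
      using \<open>K' > 0\<close> by (intro mult_left_mono K t) auto
    finally show ?thesis by (simp add: t_def mult_ac)
  qed
  then show ?thesis
    using \<open>K > 0\<close> \<open>K' > 0\<close> by (intro exI[of _ "K' * K"]) auto
qed

section \<open>Membership in the local L^q space and in the Lipschitz space\<close>

lemma indicator_qball_in_Lq_space:
  fixes f :: "'a \<Rightarrow> 'k::euclidean_space"
  assumes f: "f \<in> borel_measurable M" and x: "x \<in> space M" and r: "0 < r"
    and B: "\<And>y. y \<in> qball M d x r \<Longrightarrow> norm (f y) \<le> B" and q: "1 \<le> q"
  shows "(\<lambda>y. indicat_real (qball M d x r) y *\<^sub>R f y) \<in> Lq_space M q"
proof -
  let ?Q = "qball M d x r"
  let ?g = "\<lambda>y. indicat_real ?Q y *\<^sub>R f y"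
  have g[measurable]: "?g \<in> borel_measurable M"
    by (intro borel_measurable_scaleR borel_measurable_indicator qball_sets x f)
  have le: "norm (?g y) \<le> max B 0 * indicat_real ?Q y" for y
    using B[of y] by (auto simp: indicator_def)
  show ?thesis
  proof (cases "q = \<infinity>")
    case True
    have "norm (?g y) \<le> max B 0" for y
      using le[of y] by (auto simp: indicator_def split: if_splits)
    moreover have "(\<lambda>y. ennreal (norm (?g y))) \<in> borel_measurable M" by measurable
    ultimately have "esssup M (\<lambda>y. ennreal (norm (?g y))) \<le> ennreal (max B 0)"
      by (intro esssup_I AE_I2 ennreal_leI)
    then show ?thesis
      using True g le_less_trans[OF _ ennreal_less_top] by (auto simp: Lq_space_def)
  next
    case False
    have q0: "0 < enn2real q"
      using q False by (simp add: enn2real_positive_iff less_top less_le_trans[OF zero_less_one])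
    have "norm (?g y) powr enn2real q \<le> max B 0 powr enn2real q * indicat_real ?Q y" for y
      using powr_mono2[OF less_imp_le[OF q0] norm_ge_zero le[of y]] q0
      by (auto simp: indicator_def split: if_splits)
    then have "(\<integral>\<^sup>+y. ennreal (norm (?g y) powr enn2real q) \<partial>M)
        \<le> (\<integral>\<^sup>+y. ennreal (max B 0 powr enn2real q) * indicator ?Q y \<partial>M)"
      by (intro nn_integral_mono) (simp add: ennreal_indicator[symmetric] ennreal_mult'[symmetric] ennreal_leI)
    also have "\<dots> = ennreal (max B 0 powr enn2real q) * emeasure M ?Q"
      using qball_sets[OF x] by (simp add: nn_integral_cmult_indicator)
    also have "\<dots> < \<infinity>"
      using emeasure_qball_finite[OF x r] by (simp add: ennreal_mult_less_top)
    finally show ?thesis using False g by (simp add: Lq_space_def)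
  qed
qed

text \<open>Pointwise bounds dominate the supremum used on small balls as well as the essential
  supremum used on large ones.\<close>

lemma lip_spaceI:
  fixes f :: "'a \<Rightarrow> 'k::{real_normed_field, euclidean_space}"
  assumes f: "f \<in> borel_measurable M" and q: "1 \<le> q" and K: "0 \<le> K"
    and small: "\<And>x r y y'. x \<in> space M \<Longrightarrow> 0 < r \<Longrightarrow> r \<le> 1 \<Longrightarrow> y \<in> qball M d x r \<Longrightarrow>
        y' \<in> qball M d x r \<Longrightarrow> norm (f y - f y') \<le> K * measure M (qball M d x r) powr \<theta>"
    and large: "\<And>x r y. x \<in> space M \<Longrightarrow> 1 < r \<Longrightarrow> y \<in> qball M d x r \<Longrightarrow>
        norm (f y) \<le> K * measure M (qball M d x r) powr \<theta>"
  shows "f \<in> lip_space M d q \<theta>"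
proof -
  have "(\<lambda>y. indicat_real (qball M d x r) y *\<^sub>R f y) \<in> Lq_space M q"
    if x: "x \<in> space M" and r: "0 < r" for x r
  proof (rule indicator_qball_in_Lq_space[OF f x r _ q])
    \<comment> \<open>Every ball lies in the concentric one of radius \<open>r + 1 > 1\<close>,
      where \<open>large\<close> applies; so \<open>f\<close> is bounded on all balls, and local
      integrability follows.\<close>
    fix y assume "y \<in> qball M d x r"
    then show "norm (f y) \<le> K * measure M (qball M d x (r + 1)) powr \<theta>"
      using x r by (intro large) (auto simp: qball_def)
  qed
  then have "f \<in> Lq_on_balls M d q" using f by (simp add: Lq_on_balls_def)
  moreover have "lip_osc M d \<theta> f x r \<le> ennreal K" if x: "x \<in> space M" and r: "0 < r" for x r
  proof -
    let ?B = "qball M d x r"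
    have V: "0 < measure M ?B powr \<theta>" using measure_qball_pos[OF x r] by simp
    have eq: "ennreal (measure M ?B powr \<theta>) * ennreal K = ennreal (K * measure M ?B powr \<theta>)"
      using K by (simp add: ennreal_mult' mult.commute)
    show ?thesis
    proof (cases "r \<le> 1")
      case True
      then show ?thesis
        using V small[OF x r] unfolding lip_osc_def Let_def
        by (auto intro!: divide_le_posI_ennreal SUP_least ennreal_leI simp: eq)
    next
      case False
      have "(\<lambda>y. ennreal (norm (f y))) \<in> borel_measurable (restrict_space M ?B)"
        using f by (intro measurable_restrict_space1) measurable
      then have "esssup (restrict_space M ?B) (\<lambda>y. ennreal (norm (f y)))
          \<le> ennreal (K * measure M ?B powr \<theta>)"
        using False x by (intro esssup_I AE_I2 ennreal_leI large) (auto simp: space_restrict_space)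
      then show ?thesis
        using V False unfolding lip_osc_def Let_def
        by (auto intro!: divide_le_posI_ennreal simp: eq)
    qed
  qed
  then have "lip_norm M d \<theta> f \<le> ennreal K"
    unfolding lip_norm_def by (intro SUP_least) auto
  ultimately show ?thesis
    using le_less_trans[OF _ ennreal_less_top] by (auto simp: lip_space_def)
qed

text \<open>On balls of radius above 1 the Lipschitz quantity is an essential supremum, so the bound
  holds off a null set that may depend on the ball, whereas \<open>N\<close>, the value of the norm,
  does not.\<close>

lemma lip_space_AE_le:
  fixes f :: "'a \<Rightarrow> 'k::{real_normed_field, euclidean_space}"
  assumes "f \<in> lip_space M d q \<theta>"
  shows "\<exists>N. \<forall>x\<in>space M. \<forall>r>1. AE y in M. y \<in> qball M d x r \<longrightarrow>
           norm (f y) \<le> N * measure M (qball M d x r) powr \<theta>"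
proof -
  obtain N where N: "lip_norm M d \<theta> f = ennreal N" "0 \<le> N"
    using assms by (cases "lip_norm M d \<theta> f") (auto simp: lip_space_def)
  have "AE y in M. y \<in> qball M d x r \<longrightarrow> norm (f y) \<le> N * measure M (qball M d x r) powr \<theta>"
    if x: "x \<in> space M" and r: "1 < r" for x r
  proof -
    let ?B = "qball M d x r"
    have V: "0 < measure M ?B powr \<theta>" using measure_qball_pos[OF x, of r] r by simp
    have "esssup (restrict_space M ?B) (\<lambda>y. ennreal (norm (f y))) / ennreal (measure M ?B powr \<theta>)
        = lip_osc M d \<theta> f x r"
      using r by (simp add: lip_osc_def Let_def)
    also have "\<dots> \<le> lip_norm M d \<theta> f"
      unfolding lip_norm_def using x r by (intro SUP_upper2[of "(x, r)"]) auto
    finally have "esssup (restrict_space M ?B) (\<lambda>y. ennreal (norm (f y)))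
        / ennreal (measure M ?B powr \<theta>) * ennreal (measure M ?B powr \<theta>)
        \<le> ennreal N * ennreal (measure M ?B powr \<theta>)"
      unfolding N by (rule mult_right_mono) simp
    then have "esssup (restrict_space M ?B) (\<lambda>y. ennreal (norm (f y)))
        \<le> ennreal (N * measure M ?B powr \<theta>)"
      using V N(2) by (simp add: ennreal_divide_times ennreal_mult mult_divide_eq_ennreal)
    moreover have "AE y in restrict_space M ?B.
        ennreal (norm (f y)) \<le> esssup (restrict_space M ?B) (\<lambda>y. ennreal (norm (f y)))"
      by (rule esssup_AE)
    ultimately have "AE y in restrict_space M ?B. norm (f y) \<le> N * measure M ?B powr \<theta>"
      using N(2) by (elim eventually_mono) (auto dest: order_trans simp: ennreal_le_iff)
    then show ?thesis
      using qball_sets[OF x] by (simp add: AE_restrict_space_iff)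
  qed
  then show ?thesis by blast
qed

lemma borel_measurable_dist: "p \<in> space M \<Longrightarrow> (\<lambda>x. d x p) \<in> borel_measurable M"
proof (subst borel_measurable_iff_less, intro allI)
  fix a assume p: "p \<in> space M"
  then have "{x \<in> space M. d x p < a} = qball M d p a"
    by (auto simp: qball_def d_commute)
  then show "{x \<in> space M. d x p < a} \<in> sets M" using qball_sets[OF p] by simp
qed

end

section \<open>Wavelets of level 0: decay, oscillation and normalization\<close>

context wavelet_system
begin

lemma A_nonempty: "A k \<noteq> {}"
  using z_dense space_nonempty by blast

lemma \<phi>_decay:
  assumes "\<alpha> \<in> A 0" "x \<in> space M"
  shows "\<bar>\<phi> 0 \<alpha> x\<bar> \<le> C * measure M (qball M d (z 0 \<alpha>) 1) powr (- 1 / 2)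
           * exp (- \<nu> * d x (z 0 \<alpha>) powr s)"
  using bspec[OF conjunct1[OF \<phi>_bounds[OF assms(1), unfolded wavelet_bounds_def]] assms(2)]
  by simp

text \<open>Removes the restriction to distances at most 1, since two points of a ball of radius
  \<open>r \<le> 1\<close> may be up to \<open>2 * A0 * r\<close> apart. At larger distances
  \<open>d x y powr \<eta>\<close> is at least 1, and the size bounds at both points suffice; this
  is why both exponentials appear.\<close>

lemma \<phi>_diff_le:
  assumes \<alpha>: "\<alpha> \<in> A 0" and x: "x \<in> space M" and y: "y \<in> space M"
  shows "\<bar>\<phi> 0 \<alpha> x - \<phi> 0 \<alpha> y\<bar> \<le> C * measure M (qball M d (z 0 \<alpha>) 1) powr (- 1 / 2)
      * d x y powr \<eta> * (exp (- \<nu> * d x (z 0 \<alpha>) powr s) + exp (- \<nu> * d y (z 0 \<alpha>) powr s))"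
    (is "_ \<le> ?c * _ * (?E x + ?E y)")
proof -
  have c: "0 \<le> ?c" using C_pos by simp
  show ?thesis
  proof (cases "d x y \<le> 1")
    case True
    then have "\<bar>\<phi> 0 \<alpha> x - \<phi> 0 \<alpha> y\<bar> \<le> ?c * d x y powr \<eta> * ?E x"
      using \<phi>_bounds[OF \<alpha>] x y by (auto simp: wavelet_bounds_def)
    also have "\<dots> \<le> ?c * d x y powr \<eta> * (?E x + ?E y)"
      using c by (intro mult_left_mono) auto
    finally show ?thesis .
  next
    case False
    have "\<bar>\<phi> 0 \<alpha> x - \<phi> 0 \<alpha> y\<bar> \<le> ?c * (?E x + ?E y)"
      using \<phi>_decay[OF \<alpha> x] \<phi>_decay[OF \<alpha> y] by (simp add: distrib_left)
    also have "\<dots> \<le> ?c * d x y powr \<eta> * (?E x + ?E y)"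
    proof (rule mult_right_mono)
      have "1 \<le> d x y powr \<eta>" using False \<eta>_pos by (simp add: ge_one_powr_ge_zero)
      then show "?c \<le> ?c * d x y powr \<eta>" using mult_left_mono[OF _ c] by fastforce
    qed (simp add: add_nonneg_nonneg)
    finally show ?thesis .
  qed
qed

lemma \<phi>_L2:
  assumes "\<alpha> \<in> A 0"
  shows \<phi>_measurable: "\<phi> 0 \<alpha> \<in> borel_measurable M"
    and \<phi>_normalized: "(\<integral>\<^sup>+x. ennreal (\<phi> 0 \<alpha> x * \<phi> 0 \<alpha> x) \<partial>M) = 1"
proof -
  note o = orthonormal_basis[of 0, unfolded orthonormal_basis_L2_def]
  have "\<forall>i\<in>A 0 <+> (SIGMA k:{0..}. new_indices A z k).
      case_sum (\<phi> 0) (\<lambda>(k, \<beta>). \<psi> (k + 1) \<beta>) i \<in> Lq_space M 2"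
    using o by blast
  from bspec[OF this InlI[OF assms]] show "\<phi> 0 \<alpha> \<in> borel_measurable M"
    by (simp add: Lq_space_def)
  have "\<forall>i\<in>A 0 <+> (SIGMA k:{0..}. new_indices A z k).
    (\<integral>x. case_sum (\<phi> 0) (\<lambda>(k, \<beta>). \<psi> (k + 1) \<beta>) i x * case_sum (\<phi> 0) (\<lambda>(k, \<beta>). \<psi> (k + 1) \<beta>) i x \<partial>M) = 1"
    using o by auto
  from bspec[OF this InlI[OF assms]] have i: "(\<integral>x. \<phi> 0 \<alpha> x * \<phi> 0 \<alpha> x \<partial>M) = 1" by simp
  \<comment> \<open>The Bochner integral of a non-integrable function is 0 by convention, so the
    value 1 certifies integrability.\<close>
  then have "integrable M (\<lambda>x. \<phi> 0 \<alpha> x * \<phi> 0 \<alpha> x)"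
    using not_integrable_integral_eq by fastforce
  then show "(\<integral>\<^sup>+x. ennreal (\<phi> 0 \<alpha> x * \<phi> 0 \<alpha> x) \<partial>M) = 1"
    using i by (subst nn_integral_eq_integral) auto
qed

text \<open>In the integral of the square, which is 1, one factor is bounded by \<open>S\<close> and
  the other by the decay estimate. With V the measure of the unit ball, the latter integrates to at
  most a constant times V^(-1/2) V = V^(1/2).\<close>

lemma \<phi>_sup_lower_bound:
  "\<exists>K>0. \<forall>\<alpha>\<in>A 0. \<forall>S. (AE x in M. \<bar>\<phi> 0 \<alpha> x\<bar> \<le> S) \<longrightarrow>
      1 \<le> S * K * measure M (qball M d (z 0 \<alpha>) 1) powr (1 / 2)"
proof -
  obtain K where "K > 0"
    and K: "\<And>p. p \<in> space M \<Longrightarrow> (\<integral>\<^sup>+x. ennreal (exp (- \<nu> * d x p powr s)) \<partial>M)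
            \<le> ennreal (K * measure M (qball M d p 1))"
    using nn_integral_exp_le[OF \<nu>_pos s_pos] by blast
  have "1 \<le> S * (C * K) * measure M (qball M d (z 0 \<alpha>) 1) powr (1 / 2)"
    if \<alpha>: "\<alpha> \<in> A 0" and S: "AE x in M. \<bar>\<phi> 0 \<alpha> x\<bar> \<le> S" for \<alpha> S
  proof -
    let ?V = "measure M (qball M d (z 0 \<alpha>) 1)" and ?E = "\<lambda>x. exp (- \<nu> * d x (z 0 \<alpha>) powr s)"
    have p: "z 0 \<alpha> \<in> space M" by (rule z_in_space[OF \<alpha>])
    have V: "0 < ?V" using measure_qball_pos[OF p] by simp
    note [measurable] = borel_measurable_dist[OF p]
    \<comment> \<open>In a space of nonzero measure an almost everywhere statement holds at some
      point, which forces \<open>S\<close> to be nonnegative.\<close>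
    have "emeasure M (space M) \<noteq> 0" using emeasure_space_infinite by simp
    then have "\<exists>x. \<bar>\<phi> 0 \<alpha> x\<bar> \<le> S"
      using eventually_happens'[OF _ S] by (auto simp: ae_filter_eq_bot_iff)
    then have S0: "0 \<le> S" by (meson abs_ge_zero order_trans)
    have "1 = (\<integral>\<^sup>+x. ennreal (\<phi> 0 \<alpha> x * \<phi> 0 \<alpha> x) \<partial>M)"
      using \<phi>_normalized[OF \<alpha>] by simp
    also have "\<dots> \<le> (\<integral>\<^sup>+x. ennreal (S * C * ?V powr (- 1 / 2)) * ennreal (?E x) \<partial>M)"
    proof (rule nn_integral_mono_AE, use S AE_space in eventually_elim)
      fix x assume x: "\<bar>\<phi> 0 \<alpha> x\<bar> \<le> S" "x \<in> space M"
      have "\<phi> 0 \<alpha> x * \<phi> 0 \<alpha> x = \<bar>\<phi> 0 \<alpha> x\<bar> * \<bar>\<phi> 0 \<alpha> x\<bar>" by simp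
      also have "\<dots> \<le> S * (C * ?V powr (- 1 / 2) * ?E x)"
        using S0 by (intro mult_mono x \<phi>_decay \<alpha>) auto
      finally show "ennreal (\<phi> 0 \<alpha> x * \<phi> 0 \<alpha> x) \<le> ennreal (S * C * ?V powr (- 1 / 2)) * ennreal (?E x)"
        using S0 C_pos by (simp add: ennreal_mult'[symmetric] ennreal_leI mult_ac)
    qed
    also have "\<dots> = ennreal (S * C * ?V powr (- 1 / 2)) * (\<integral>\<^sup>+x. ennreal (?E x) \<partial>M)"
      by (rule nn_integral_cmult) measurable
    also have "\<dots> \<le> ennreal (S * C * ?V powr (- 1 / 2)) * ennreal (K * ?V)"
      by (intro mult_left_mono K p) auto
    also have "\<dots> = ennreal (S * (C * K) * (?V powr (- 1 / 2) * ?V powr 1))"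
      using S0 C_pos V \<open>K > 0\<close> by (simp add: ennreal_mult'[symmetric] mult_ac)
    also have "?V powr (- 1 / 2) * ?V powr 1 = ?V powr (1 / 2)"
      by (subst powr_add[symmetric]) simp
    finally show ?thesis by simp
  qed
  then show ?thesis using \<open>K > 0\<close> C_pos by (intro exI[of _ "C * K"]) auto
qed

section \<open>The weighted supremum of wavelets as test function, and necessity of bounded unit
  balls\<close>

definition sup_wavelet :: "real \<Rightarrow> 'a \<Rightarrow> real" where
  "sup_wavelet \<theta> x = (SUP \<alpha>\<in>A 0. measure M (qball M d (z 0 \<alpha>) 1) powr (\<theta> + 1 / 2) * \<bar>\<phi> 0 \<alpha> x\<bar>)"

text \<open>The size estimate treats each index separately because it also supplies the boundedness
  that gives the real supremum a meaning. The oscillation estimate passes to the supremum because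
  its constant is uniform in the index.\<close>

lemma sup_wavelet_bounds:
  assumes "0 < \<theta>" "upper_dim M d * \<theta> \<le> \<eta>"
  shows "\<exists>K>0. \<forall>x\<in>space M. \<forall>r>0. \<forall>y\<in>qball M d x r.
      (\<forall>\<alpha>\<in>A 0. measure M (qball M d (z 0 \<alpha>) 1) powr (\<theta> + 1 / 2) * \<bar>\<phi> 0 \<alpha> y\<bar>
          \<le> K * min r 1 powr - (upper_dim M d * \<theta>) * measure M (qball M d x r) powr \<theta>) \<and>
      (r \<le> 1 \<longrightarrow> (\<forall>y'\<in>qball M d x r. \<bar>sup_wavelet \<theta> y - sup_wavelet \<theta> y'\<bar>
          \<le> K * measure M (qball M d x r) powr \<theta>))"
proof -
  let ?w = "upper_dim M d"
  define V where "V \<alpha> = measure M (qball M d (z 0 \<alpha>) 1)" for \<alpha>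
  define E where "E \<alpha> y = exp (- \<nu> * d y (z 0 \<alpha>) powr s)" for \<alpha> y
  define g where "g \<alpha> y = V \<alpha> powr (\<theta> + 1 / 2) * \<bar>\<phi> 0 \<alpha> y\<bar>" for \<alpha> y
  obtain K where "K > 0"
    and K: "\<And>\<alpha> x r y. \<alpha> \<in> A 0 \<Longrightarrow> x \<in> space M \<Longrightarrow> 0 < r \<Longrightarrow> y \<in> qball M d x r \<Longrightarrow>
     V \<alpha> powr \<theta> * E \<alpha> y \<le> K * min r 1 powr - (?w * \<theta>) * measure M (qball M d x r) powr \<theta>"
    using weighted_exp_le[OF \<nu>_pos s_pos assms(1)] z_in_space unfolding V_def E_def by metis
  \<comment> \<open>The 2 counts the two exponentials in the oscillation bound;
    \<open>(2 * A0) powr \<eta>\<close> comes from the distance of two points in a ball of radius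
    \<open>r\<close>.\<close>
  define L where "L = 2 * C * (2 * A0) powr \<eta> * K"
  have L: "0 < L" using C_pos A0_ge_1 \<open>K > 0\<close> by (simp add: L_def)
  \<comment> \<open>The summand 1/2 in the weight undoes the L^2 normalization and leaves exactly
    the power controlled by \<open>K\<close>.\<close>
  have absorb: "V \<alpha> powr (\<theta> + 1 / 2) * (C * V \<alpha> powr (- 1 / 2) * X) = C * (V \<alpha> powr \<theta> * X)"
    if "\<alpha> \<in> A 0" for \<alpha> X
  proof -
    have "V \<alpha> powr (\<theta> + 1 / 2) * V \<alpha> powr (- 1 / 2) = V \<alpha> powr \<theta>"
      by (simp add: powr_add[symmetric])
    then show ?thesis by (simp add: mult_ac)
  qed
  have size: "g \<alpha> y \<le> C * K * min r 1 powr - (?w * \<theta>) * measure M (qball M d x r) powr \<theta>"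
    if "\<alpha> \<in> A 0" "x \<in> space M" "0 < r" and y: "y \<in> qball M d x r" for \<alpha> x r y
  proof -
    have "\<bar>\<phi> 0 \<alpha> y\<bar> \<le> C * V \<alpha> powr (- 1 / 2) * E \<alpha> y"
      using \<phi>_decay[OF that(1)] y by (simp add: qball_def V_def E_def)
    then have "g \<alpha> y \<le> V \<alpha> powr (\<theta> + 1 / 2) * (C * V \<alpha> powr (- 1 / 2) * E \<alpha> y)"
      unfolding g_def by (rule mult_left_mono) simp
    also have "\<dots> = C * (V \<alpha> powr \<theta> * E \<alpha> y)" by (rule absorb[OF that(1)])
    also have "\<dots> \<le> C * (K * min r 1 powr - (?w * \<theta>) * measure M (qball M d x r) powr \<theta>)"
      using C_pos by (intro mult_left_mono K that) auto
    finally show ?thesis by (simp add: mult_ac)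
  qed
  have bdd: "bdd_above ((\<lambda>\<alpha>. g \<alpha> y) ` A 0)" if "y \<in> space M" for y
    using size[OF _ that, of _ 1 y] that d_eq_0_iff[of y y] by (auto intro!: bdd_aboveI2 simp: qball_def)
  have sup: "sup_wavelet \<theta> y = (SUP \<alpha>\<in>A 0. g \<alpha> y)" for y
    by (simp add: sup_wavelet_def g_def V_def)
  have osc: "\<bar>g \<alpha> y - g \<alpha> y'\<bar> \<le> L * measure M (qball M d x r) powr \<theta>"
    if \<alpha>: "\<alpha> \<in> A 0" and x: "x \<in> space M" and r: "0 < r" "r \<le> 1"
      and y: "y \<in> qball M d x r" and y': "y' \<in> qball M d x r" for \<alpha> x r y y'
  proof -
    let ?B = "measure M (qball M d x r) powr \<theta>"
    have yM: "y \<in> space M" "y' \<in> space M" "d x y < r" "d x y' < r"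
      using y y' by (auto simp: qball_def)
    have "d y y' \<le> A0 * (d y x + d x y')" by (rule d_triangle) (use yM x in auto)
    also have "\<dots> \<le> A0 * (2 * r)"
      using yM A0_ge_1 d_commute[of y x] x by (intro mult_left_mono) auto
    finally have "d y y' \<le> 2 * A0 * r" by simp
    then have dist: "d y y' powr \<eta> \<le> (2 * A0) powr \<eta> * r powr \<eta>"
      using d_nonneg yM \<eta>_pos A0_ge_1 r by (subst powr_mult[symmetric]) (auto intro!: powr_mono2)
    have "\<bar>g \<alpha> y - g \<alpha> y'\<bar> = V \<alpha> powr (\<theta> + 1 / 2) * \<bar>\<bar>\<phi> 0 \<alpha> y\<bar> - \<bar>\<phi> 0 \<alpha> y'\<bar>\<bar>"
      by (simp add: g_def abs_mult right_diff_distrib[symmetric])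
    also have "\<dots> \<le> V \<alpha> powr (\<theta> + 1 / 2) * \<bar>\<phi> 0 \<alpha> y - \<phi> 0 \<alpha> y'\<bar>"
      by (intro mult_left_mono abs_triangle_ineq3) auto
    also have "\<dots> \<le> V \<alpha> powr (\<theta> + 1 / 2)
        * (C * V \<alpha> powr (- 1 / 2) * (d y y' powr \<eta> * (E \<alpha> y + E \<alpha> y')))"
      using \<phi>_diff_le[OF \<alpha> yM(1,2)] by (intro mult_left_mono) (auto simp: V_def E_def mult_ac)
    also have "\<dots> = C * d y y' powr \<eta> * (V \<alpha> powr \<theta> * E \<alpha> y + V \<alpha> powr \<theta> * E \<alpha> y')"
      unfolding absorb[OF \<alpha>] by (simp add: algebra_simps)
    also have "\<dots> \<le> C * ((2 * A0) powr \<eta> * r powr \<eta>)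
        * (K * r powr - (?w * \<theta>) * ?B + K * r powr - (?w * \<theta>) * ?B)"
      using K[OF \<alpha> x r(1) y] K[OF \<alpha> x r(1) y'] r C_pos
      by (intro mult_mono[OF mult_left_mono[OF dist] add_mono]) (auto simp: min_def E_def)
    also have "\<dots> = L * (r powr \<eta> * r powr - (?w * \<theta>)) * ?B"
      by (simp add: L_def algebra_simps)
    \<comment> \<open>Here the smoothness pays for the loss on small balls: the exponent is
      nonnegative and \<open>r \<le> 1\<close>, so this power is at most 1.\<close>
    also have "r powr \<eta> * r powr - (?w * \<theta>) = r powr (\<eta> - ?w * \<theta>)"
      by (simp add: powr_add[symmetric])
    also have "L * r powr (\<eta> - ?w * \<theta>) * ?B \<le> L * 1 * ?B"
      using L r assms by (intro mult_right_mono mult_left_mono powr_le1) auto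
    finally show ?thesis by simp
  qed
  show ?thesis
  proof (intro exI[of _ "max (C * K) L"] conjI ballI allI impI)
    show "0 < max (C * K) L" using L by simp
  next
    fix x r y \<alpha> assume a: "x \<in> space M" "(0::real) < r" "y \<in> qball M d x r" "\<alpha> \<in> A 0"
    have "g \<alpha> y \<le> C * K * (min r 1 powr - (?w * \<theta>) * measure M (qball M d x r) powr \<theta>)"
      using size[OF a(4,1,2,3)] by (simp add: mult_ac)
    also have "\<dots> \<le> max (C * K) L * (min r 1 powr - (?w * \<theta>) * measure M (qball M d x r) powr \<theta>)"
      by (intro mult_right_mono) auto
    finally show "measure M (qball M d (z 0 \<alpha>) 1) powr (\<theta> + 1 / 2) * \<bar>\<phi> 0 \<alpha> y\<bar>
        \<le> max (C * K) L * min r 1 powr - (?w * \<theta>) * measure M (qball M d x r) powr \<theta>"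
      by (simp add: g_def V_def mult_ac)
  next
    fix x r y y' assume a: "x \<in> space M" "(0::real) < r" "y \<in> qball M d x r" "r \<le> 1" "y' \<in> qball M d x r"
    have "\<bar>sup_wavelet \<theta> y - sup_wavelet \<theta> y'\<bar> \<le> L * measure M (qball M d x r) powr \<theta>"
      unfolding sup
      by (intro abs_cSUP_diff_le A_nonempty bdd osc a) (use a in \<open>auto simp: qball_def\<close>)
    also have "\<dots> \<le> max (C * K) L * measure M (qball M d x r) powr \<theta>"
      by (intro mult_right_mono) auto
    finally show "\<bar>sup_wavelet \<theta> y - sup_wavelet \<theta> y'\<bar>
        \<le> max (C * K) L * measure M (qball M d x r) powr \<theta>" .
  qed
qed

lemma bdd_above_sup_wavelet:
  assumes "0 < \<theta>" "upper_dim M d * \<theta> \<le> \<eta>" "x \<in> space M"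
  shows "bdd_above ((\<lambda>\<alpha>. measure M (qball M d (z 0 \<alpha>) 1) powr (\<theta> + 1 / 2) * \<bar>\<phi> 0 \<alpha> x\<bar>) ` A 0)"
proof -
  have "x \<in> qball M d x 1" using assms(3) d_eq_0_iff[of x x] by (simp add: qball_def)
  then obtain K where "\<forall>\<alpha>\<in>A 0. measure M (qball M d (z 0 \<alpha>) 1) powr (\<theta> + 1 / 2) * \<bar>\<phi> 0 \<alpha> x\<bar>
      \<le> K * min 1 1 powr - (upper_dim M d * \<theta>) * measure M (qball M d x 1) powr \<theta>"
    using sup_wavelet_bounds[OF assms(1,2)] assms(3) zero_less_one by blast
  then show ?thesis by (intro bdd_aboveI2) blast
qed

text \<open>\<open>of_real\<close> carries the test function into the scalar field of the Lipschitz
  space and preserves norms, so the real estimates suffice.\<close>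

lemma sup_wavelet_lip:
  assumes \<theta>: "0 < \<theta>" "upper_dim M d * \<theta> \<le> \<eta>" and q: "1 \<le> q"
  shows "(\<lambda>x. of_real (sup_wavelet \<theta> x) :: 'k::{real_normed_field, euclidean_space})
           \<in> lip_space M d q \<theta>"
proof -
  obtain K where K: "0 < K"
    and size: "\<And>x r y \<alpha>. x \<in> space M \<Longrightarrow> 0 < r \<Longrightarrow> y \<in> qball M d x r \<Longrightarrow> \<alpha> \<in> A 0 \<Longrightarrow>
       measure M (qball M d (z 0 \<alpha>) 1) powr (\<theta> + 1 / 2) * \<bar>\<phi> 0 \<alpha> y\<bar>
          \<le> K * min r 1 powr - (upper_dim M d * \<theta>) * measure M (qball M d x r) powr \<theta>"
    and osc: "\<And>x r y y'. x \<in> space M \<Longrightarrow> 0 < r \<Longrightarrow> y \<in> qball M d x r \<Longrightarrow> r \<le> 1 \<Longrightarrow>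
       y' \<in> qball M d x r \<Longrightarrow> \<bar>sup_wavelet \<theta> y - sup_wavelet \<theta> y'\<bar>
          \<le> K * measure M (qball M d x r) powr \<theta>"
    using sup_wavelet_bounds[OF \<theta>] by blast
  show ?thesis
  proof (rule lip_spaceI[OF _ q less_imp_le[OF K]])
    have "sup_wavelet \<theta> \<in> borel_measurable M"
      \<comment> \<open>The supremum is measurable because it runs over a countable family that is
        bounded at each point.\<close>
      unfolding sup_wavelet_def[abs_def]
      by (intro borel_measurable_cSUP bdd_above_sup_wavelet \<theta> countable_A borel_measurable_times
          borel_measurable_const borel_measurable_abs \<phi>_measurable)
    then show "(\<lambda>x. of_real (sup_wavelet \<theta> x) :: 'k) \<in> borel_measurable M" by measurable
  next
    fix x r y y' assume "x \<in> space M" "0 < r" "r \<le> 1" "y \<in> qball M d x r" "y' \<in> qball M d x r"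
    from osc[OF this(1,2,4,3,5)]
    show "norm (of_real (sup_wavelet \<theta> y) - of_real (sup_wavelet \<theta> y') :: 'k)
        \<le> K * measure M (qball M d x r) powr \<theta>"
      unfolding of_real_diff[symmetric] norm_of_real .
  next
    fix x y and r :: real assume a: "x \<in> space M" "1 < r" "y \<in> qball M d x r"
    \<comment> \<open>For \<open>r > 1\<close> the factor \<open>min r 1\<close> is 1, so the size
      estimate carries no loss.\<close>
    then have le: "measure M (qball M d (z 0 \<alpha>) 1) powr (\<theta> + 1 / 2) * \<bar>\<phi> 0 \<alpha> y\<bar>
          \<le> K * measure M (qball M d x r) powr \<theta>" if "\<alpha> \<in> A 0" for \<alpha>
      using size[of x r y \<alpha>] that by (simp add: min_def)
    have y: "y \<in> space M" using a by (simp add: qball_def)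
    obtain \<alpha> where "\<alpha> \<in> A 0" using A_nonempty by blast
    then have "0 \<le> sup_wavelet \<theta> y"
      unfolding sup_wavelet_def by (intro cSUP_upper2[OF bdd_above_sup_wavelet[OF \<theta> y]]) auto
    moreover have "sup_wavelet \<theta> y \<le> K * measure M (qball M d x r) powr \<theta>"
      unfolding sup_wavelet_def by (intro cSUP_least A_nonempty le)
    ultimately show "norm (of_real (sup_wavelet \<theta> y) :: 'k) \<le> K * measure M (qball M d x r) powr \<theta>"
      by simp
  qed
qed

text \<open>The wavelets control the unit balls centred at dyadic points of level 0; every other
  unit ball lies in a fixed dilate of one of these, and doubling transfers the bound.\<close>

lemma measure_unit_ball_bounded:
  assumes \<theta>: "0 < \<theta>" "upper_dim M d * \<theta> \<le> \<eta>"
    and N: "AE x in M. sup_wavelet \<theta> x \<le> N"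
  shows "\<exists>B>0. \<forall>x\<in>space M. measure M (qball M d x 1) \<le> B"
proof -
  obtain K where "K > 0"
    and K: "\<And>\<alpha> S. \<alpha> \<in> A 0 \<Longrightarrow> AE x in M. \<bar>\<phi> 0 \<alpha> x\<bar> \<le> S \<Longrightarrow>
      1 \<le> S * K * measure M (qball M d (z 0 \<alpha>) 1) powr (1 / 2)"
    using \<phi>_sup_lower_bound by blast
  \<comment> \<open>With \<open>S = N * ?V powr - (\<theta> + 1 / 2)\<close> the lower bound for
    \<open>S\<close> becomes \<open>1 \<le> N * K * ?V powr - \<theta>\<close>, which is solved for
    \<open>?V\<close>.\<close>
  have centre: "measure M (qball M d (z 0 \<alpha>) 1) \<le> (max N 0 * K) powr (1 / \<theta>)" if \<alpha>: "\<alpha> \<in> A 0" for \<alpha>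
  proof -
    let ?V = "measure M (qball M d (z 0 \<alpha>) 1)"
    have V: "0 < ?V" using measure_qball_pos z_in_space[OF \<alpha>] by simp
    have "AE x in M. \<bar>\<phi> 0 \<alpha> x\<bar> \<le> N * ?V powr - (\<theta> + 1 / 2)"
      using N AE_space
    proof eventually_elim
      case (elim x)
      have "?V powr (\<theta> + 1 / 2) * \<bar>\<phi> 0 \<alpha> x\<bar> \<le> sup_wavelet \<theta> x"
        unfolding sup_wavelet_def using elim \<alpha> by (intro cSUP_upper bdd_above_sup_wavelet \<theta>)
      then show ?case using elim V by (simp add: powr_minus field_simps)
    qed
    from K[OF \<alpha> this] have "1 \<le> N * K * (?V powr - (\<theta> + 1 / 2) * ?V powr (1 / 2))"
      by (simp add: mult_ac)
    also have "?V powr - (\<theta> + 1 / 2) * ?V powr (1 / 2) = ?V powr - \<theta>"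
      by (subst powr_add[symmetric]) simp
    finally have "?V powr \<theta> \<le> N * K" using V by (simp add: powr_minus field_simps)
    also have "\<dots> \<le> max N 0 * K" using \<open>K > 0\<close> by simp
    finally have "(?V powr \<theta>) powr (1 / \<theta>) \<le> (max N 0 * K) powr (1 / \<theta>)"
      using \<theta> by (intro powr_mono2) auto
    then show ?thesis using V \<theta> by (simp add: powr_powr)
  qed
  \<comment> \<open>A dyadic point of level 0 lies within \<open>C0\<close> of \<open>x\<close>, so
    the ball of radius \<open>A0 * (C0 + 1)\<close> around it contains the unit ball at
    \<open>x\<close>.\<close>
  let ?B = "doubling_const M d * (A0 * (C0 + 1)) powr upper_dim M d * (max N 0 * K) powr (1 / \<theta>)"
  have "measure M (qball M d x 1) \<le> ?B" if x: "x \<in> space M" for x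
  proof -
    obtain \<alpha> where \<alpha>: "\<alpha> \<in> A 0" "d x (z 0 \<alpha>) < C0"
      using z_dense[OF x, of 0] by auto
    have p: "z 0 \<alpha> \<in> space M" by (rule z_in_space[OF \<alpha>(1)])
    have l: "1 \<le> A0 * (C0 + 1)"
      using mult_mono[of 1 A0 1 "C0 + 1"] A0_ge_1 c0_pos c0_less_C0 by simp
    have "qball M d x 1 \<subseteq> qball M d (z 0 \<alpha>) (A0 * (C0 + 1) * 1)"
    proof
      fix y assume "y \<in> qball M d x 1"
      then have y: "y \<in> space M" "d x y < 1" by (auto simp: qball_def)
      have "d (z 0 \<alpha>) y \<le> A0 * (d (z 0 \<alpha>) x + d x y)" by (rule d_triangle[OF p x y(1)])
      also have "\<dots> < A0 * (C0 + 1)"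
        using \<alpha>(2) y(2) A0_ge_1 d_commute[OF p x] by (intro mult_strict_left_mono) auto
      finally show "y \<in> qball M d (z 0 \<alpha>) (A0 * (C0 + 1) * 1)" using y by (simp add: qball_def)
    qed
    then have "measure M (qball M d x 1) \<le> measure M (qball M d (z 0 \<alpha>) (A0 * (C0 + 1) * 1))"
      using x p l by (intro measure_qball_mono) auto
    also have "\<dots> \<le> doubling_const M d * (A0 * (C0 + 1)) powr upper_dim M d
        * measure M (qball M d (z 0 \<alpha>) 1)"
      by (rule measure_qball_scale[OF p _ l]) simp
    also have "\<dots> \<le> ?B"
      using doubling_const_ge_1 by (intro mult_left_mono centre \<alpha>) auto
    finally show ?thesis .
  qed
  then show ?thesis by (intro exI[of _ "max ?B 1"]) (auto simp: le_max_iff_disj)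
qed

section \<open>Sufficiency of bounded unit balls, and the equivalence\<close>

lemma lip_space_subset_Linf:
  assumes \<theta>: "0 < \<theta>" and B: "\<And>x. x \<in> space M \<Longrightarrow> measure M (qball M d x 1) \<le> B"
  shows "(lip_space M d q \<theta> :: ('a \<Rightarrow> 'k::{real_normed_field, euclidean_space}) set) \<subseteq> Lq_space M \<infinity>"
proof
  fix f :: "'a \<Rightarrow> 'k" assume f: "f \<in> lip_space M d q \<theta>"
  then have meas: "f \<in> borel_measurable M" by (simp add: lip_space_def Lq_on_balls_def)
  obtain N where N: "\<And>x r. x \<in> space M \<Longrightarrow> 1 < r \<Longrightarrow> AE y in M. y \<in> qball M d x r \<longrightarrow>
           norm (f y) \<le> N * measure M (qball M d x r) powr \<theta>"
    using lip_space_AE_le[OF f] by blast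
  \<comment> \<open>At least \<open>C0\<close>, so that the balls around the points of level 0 cover
    the space, and above 1, so that their radius falls under the essential supremum part of the
    norm.\<close>
  define R where "R = max C0 2"
  let ?K = "max N 0 * (doubling_const M d * R powr upper_dim M d * B) powr \<theta>"
  \<comment> \<open>Each ball has its own exceptional set; countability of \<open>A 0\<close> merges
    them into a single null set.\<close>
  have "AE y in M. \<forall>\<alpha>\<in>A 0. y \<in> qball M d (z 0 \<alpha>) R \<longrightarrow> norm (f y) \<le> ?K"
  proof (rule AE_ball_countable'[OF _ countable_A])
    fix \<alpha> assume \<alpha>: "\<alpha> \<in> A 0"
    have p: "z 0 \<alpha> \<in> space M" by (rule z_in_space[OF \<alpha>])
    have "measure M (qball M d (z 0 \<alpha>) (R * 1))
        \<le> doubling_const M d * R powr upper_dim M d * measure M (qball M d (z 0 \<alpha>) 1)"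
      by (rule measure_qball_scale) (auto simp: p R_def)
    also have "\<dots> \<le> doubling_const M d * R powr upper_dim M d * B"
      using doubling_const_ge_1 by (intro mult_left_mono B p) auto
    finally have "N * measure M (qball M d (z 0 \<alpha>) R) powr \<theta> \<le> ?K"
      using \<theta> by (intro mult_mono powr_mono2) auto
    moreover have "1 < R" by (simp add: R_def)
    ultimately show "AE y in M. y \<in> qball M d (z 0 \<alpha>) R \<longrightarrow> norm (f y) \<le> ?K"
      using N[OF p, of R] by (auto elim!: eventually_mono)
  qed
  then have "AE y in M. norm (f y) \<le> ?K"
    using AE_space
  proof eventually_elim
    case (elim y)
    obtain \<alpha> where \<alpha>: "\<alpha> \<in> A 0" "d y (z 0 \<alpha>) < C0"
      using z_dense[OF elim(2), of 0] by auto
    then have "y \<in> qball M d (z 0 \<alpha>) R"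
      using elim(2) d_commute[OF elim(2) z_in_space[OF \<alpha>(1)]] by (simp add: qball_def R_def)
    then show ?case using elim(1) \<alpha>(1) by blast
  qed
  then have "esssup M (\<lambda>y. ennreal (norm (f y))) \<le> ennreal ?K"
    using meas by (intro esssup_I) (auto elim!: eventually_mono intro: ennreal_leI)
  then show "f \<in> Lq_space M \<infinity>"
    using meas le_less_trans[OF _ ennreal_less_top] by (auto simp: Lq_space_def)
qed

end

theorem corollary4p2:
  fixes M :: "'a measure" and d :: "'a \<Rightarrow> 'a \<Rightarrow> real" and A0 c0 C0 \<delta> :: real
    and A :: "int \<Rightarrow> 'i set" and z :: "int \<Rightarrow> 'i \<Rightarrow> 'a"
    and \<phi> \<psi> :: "int \<Rightarrow> 'i \<Rightarrow> 'a \<Rightarrow> real" and s \<eta> \<nu> Cw \<theta> :: real and q :: ennreal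
  assumes "wavelet_system M d A0 c0 C0 \<delta> A z \<phi> \<psi> s \<eta> \<nu> Cw"
    and "1 \<le> q"
    and "0 < \<theta>" and "\<theta> < \<eta> / upper_dim M d"
  shows "(lip_space M d q \<theta> :: ('a \<Rightarrow> 'k::{real_normed_field, euclidean_space}) set)
            \<subseteq> Lq_space M \<infinity>
         \<longleftrightarrow> (\<exists>C::real. 0 < C \<and> (\<forall>x\<in>space M. emeasure M (qball M d x 1) \<le> ennreal C))"
proof -
  interpret wavelet_system M d A0 c0 C0 \<delta> A z \<phi> \<psi> s \<eta> \<nu> Cw by (rule assms(1))
  \<comment> \<open>Division by 0 yields 0, so in dimension 0 the upper bound on \<theta> would read
    \<open>\<theta> < 0\<close>, against its positivity.\<close>
  have "upper_dim M d \<noteq> 0" using assms(3,4) by auto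
  then have w: "upper_dim M d * \<theta> \<le> \<eta>"
    using assms(4) upper_dim_nonneg by (simp add: field_simps)
  show ?thesis
  proof
    assume sub: "(lip_space M d q \<theta> :: ('a \<Rightarrow> 'k) set) \<subseteq> Lq_space M \<infinity>"
    let ?f = "\<lambda>x. of_real (sup_wavelet \<theta> x) :: 'k"
    have "?f \<in> Lq_space M \<infinity>" using sub sup_wavelet_lip[OF assms(3) w assms(2)] by blast
    then obtain N where N: "esssup M (\<lambda>x. ennreal (norm (?f x))) = ennreal N" "0 \<le> N"
      by (cases "esssup M (\<lambda>x. ennreal (norm (?f x)))") (auto simp: Lq_space_def)
    have "AE x in M. ennreal (norm (?f x)) \<le> ennreal N"
      using esssup_AE[of "\<lambda>x. ennreal (norm (?f x))" M] unfolding N .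
    then have "AE x in M. sup_wavelet \<theta> x \<le> N"
      using N(2) by (auto elim!: eventually_mono simp: ennreal_le_iff)
    from measure_unit_ball_bounded[OF assms(3) w this]
    show "\<exists>C::real. 0 < C \<and> (\<forall>x\<in>space M. emeasure M (qball M d x 1) \<le> ennreal C)"
      by (auto simp: emeasure_qball_eq intro: ennreal_leI)
  next
    assume "\<exists>C::real. 0 < C \<and> (\<forall>x\<in>space M. emeasure M (qball M d x 1) \<le> ennreal C)"
    then obtain B where "0 < B" "\<And>x. x \<in> space M \<Longrightarrow> measure M (qball M d x 1) \<le> B"
      by (auto simp: emeasure_qball_eq ennreal_le_iff)
    then show "(lip_space M d q \<theta> :: ('a \<Rightarrow> 'k) set) \<subseteq> Lq_space M \<infinity>"
      by (intro lip_space_subset_Linf[OF assms(3)])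
  qed
qed

end
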